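(* Let $h_1\ge\dots\ge h_n>0$ be integers with $n\ge 2$ and $N=h_1+\dots+h_n$. If a $\mathrm{LC}(h_1\dots h_n)$ exists, then $h_i\le N/2$ for all $1\le i\le n$.
   Context: A latin cube of order $N$ is an $N\times N\times N$ array on $N$ symbols such that any two cells whose coordinates differ in exactly one position contain different symbols; a subcube is an $m\times m\times m$ subarray (indices in each coordinate from chosen $m$-sets) that is itself a latin cube of order $m$; subcubes are disjoint if they share no index in any coordinate and no symbol. A $\mathrm{LC}(h_1\dots h_n)$ is a latin cube of order $N=\sum h_i$ with pairwise disjoint subcubes of orders $h_1,\dots,h_n$. *)

theory Defs
  imports Complex_Main "HOL-Library.Disjoint_Sets"
begin

definition differ_in_one :: "'a \<times> 'b \<times> 'c \<Rightarrow> 'a \<times> 'b \<times> 'c \<Rightarrow> bool" where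
  "differ_in_one = (\<lambda>(r, c, l) (r', c', l').
     (r \<noteq> r' \<and> c = c' \<and> l = l') \<or> (r = r' \<and> c \<noteq> c' \<and> l = l') \<or> (r = r' \<and> c = c' \<and> l \<noteq> l'))"

text \<open>The array is a function on triples, of which only the values on
  \<open>R \<times> C \<times> K\<close> matter; \<open>S\<close> is its symbol set. Keeping the index sets explicit lets the
  same definition apply to subarrays.\<close>

definition latin_cube_on ::
  "nat \<Rightarrow> 'a set \<Rightarrow> 'b set \<Rightarrow> 'c set \<Rightarrow> 's set \<Rightarrow> ('a \<times> 'b \<times> 'c \<Rightarrow> 's) \<Rightarrow> bool" where
  "latin_cube_on m R C K S L \<longleftrightarrow>
     finite R \<and> card R = m \<and> finite C \<and> card C = m \<and> finite K \<and> card K = m \<and>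
     finite S \<and> card S = m \<and> L ` (R \<times> C \<times> K) \<subseteq> S \<and>
     (\<forall>x \<in> R \<times> C \<times> K. \<forall>y \<in> R \<times> C \<times> K. differ_in_one x y \<longrightarrow> L x \<noteq> L y)"

definition latin_cube :: "nat \<Rightarrow> 's set \<Rightarrow> (nat \<times> nat \<times> nat \<Rightarrow> 's) \<Rightarrow> bool" where
  "latin_cube N S L \<longleftrightarrow> latin_cube_on N {1..N} {1..N} {1..N} S L"

definition subcube ::
  "nat \<Rightarrow> (nat \<times> nat \<times> nat \<Rightarrow> 's) \<Rightarrow> nat \<Rightarrow> nat set \<Rightarrow> nat set \<Rightarrow> nat set \<Rightarrow> bool" where
  "subcube N L m R C K \<longleftrightarrow>
     R \<subseteq> {1..N} \<and> C \<subseteq> {1..N} \<and> K \<subseteq> {1..N} \<and>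
     latin_cube_on m R C K (L ` (R \<times> C \<times> K)) L"

text \<open>The parameters \<open>h\<^sub>1, \<dots>, h\<^sub>n\<close> are the values of \<open>h\<close> on \<open>{1..n}\<close>.\<close>

definition LC :: "nat \<Rightarrow> (nat \<Rightarrow> nat) \<Rightarrow> 's set \<Rightarrow> (nat \<times> nat \<times> nat \<Rightarrow> 's) \<Rightarrow> bool" where
  "LC n h S L \<longleftrightarrow>
     (let N = \<Sum>i=1..n. h i in
       latin_cube N S L \<and>
       (\<exists>R C K.
          (\<forall>i\<in>{1..n}. subcube N L (h i) (R i) (C i) (K i)) \<and>
          disjoint_family_on R {1..n} \<and>
          disjoint_family_on C {1..n} \<and>
          disjoint_family_on K {1..n} \<and>
          disjoint_family_on (\<lambda>i. L ` (R i \<times> C i \<times> K i)) {1..n}))"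

end

theory Submission
  imports Defs
begin

text \<open>Let a proper subcube of order \<open>m\<close> lie on \<open>R \<times> C \<times> K\<close>, and fix a layer \<open>k \<in> K\<close> and
  an index \<open>c \<notin> C\<close>. For \<open>r \<in> R\<close> the line \<open>{r} \<times> C \<times> {k}\<close> already uses every symbol of the
  subcube, so the \<open>m\<close> distinct symbols in \<open>R \<times> {c} \<times> {k}\<close> all lie among the \<open>N - m\<close>
  symbols outside the subcube.\<close>

lemma subcube_line_image:
  assumes sub: "subcube N L m R C K" and r: "r \<in> R" and k: "k \<in> K"
  shows "(\<lambda>c. L (r, c, k)) ` C = L ` (R \<times> C \<times> K)"
\<comment> \<open>Inclusion plus a count: the entries of the line are pairwise distinct, so it
  carries m symbols, and the subcube has only m.\<close>
proof (rule card_subset_eq)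
  have cube: "latin_cube_on m R C K (L ` (R \<times> C \<times> K)) L"
    using sub by (simp add: subcube_def)
  show "finite (L ` (R \<times> C \<times> K))"
    using cube by (simp add: latin_cube_on_def)
  show "(\<lambda>c. L (r, c, k)) ` C \<subseteq> L ` (R \<times> C \<times> K)"
    using r k by auto
  have "L (r, c, k) \<noteq> L (r, c', k)" if "c \<in> C" "c' \<in> C" "c \<noteq> c'" for c c'
  proof -
    have "differ_in_one (r, c, k) (r, c', k)"
      using that by (simp add: differ_in_one_def)
    then show ?thesis
      using cube r k that unfolding latin_cube_on_def by blast
  qed
  then have "inj_on (\<lambda>c. L (r, c, k)) C"
    by (meson inj_onI)
  then show "card ((\<lambda>c. L (r, c, k)) ` C) = card (L ` (R \<times> C \<times> K))"
    using cube by (simp add: card_image latin_cube_on_def)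
qed

lemma proper_subcube_order_le:
  assumes cube: "latin_cube N S L" and sub: "subcube N L m R C K" and "m < N"
  shows "2 * m \<le> N"
\<comment> \<open>A layer k can be chosen in K only if K is nonempty, so the trivial order 0 is
  split off.\<close>
proof (cases "m = 0")
  case False
  let ?T = "L ` (R \<times> C \<times> K)"
  have bounds: "R \<subseteq> {1..N}" "C \<subseteq> {1..N}" "K \<subseteq> {1..N}"
    and cards: "card R = m" "card C = m" "card K = m" "card ?T = m" "finite ?T"
    using sub by (auto simp: subcube_def latin_cube_on_def)
  have S: "finite S" "card S = N" and LS: "L ` ({1..N} \<times> {1..N} \<times> {1..N}) \<subseteq> S"
    using cube unfolding latin_cube_def latin_cube_on_def by auto
  have neq: "L x \<noteq> L y"
    if "x \<in> {1..N} \<times> {1..N} \<times> {1..N}" "y \<in> {1..N} \<times> {1..N} \<times> {1..N}" "differ_in_one x y"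
    for x y
    using cube that unfolding latin_cube_def latin_cube_on_def by blast
  have "K \<noteq> {}"
    using cards False by auto
  then obtain k where k: "k \<in> K"
    by blast
  \<comment> \<open>Properness of the subcube enters here: it provides an index c outside C.\<close>
  have "C \<noteq> {1..N}"
    using cards \<open>m < N\<close> by auto
  then obtain c where c: "c \<in> {1..N}" "c \<notin> C"
    using bounds by blast
  have kN: "k \<in> {1..N}"
    using k bounds by blast
  have "inj_on (\<lambda>r. L (r, c, k)) R"
  proof (rule inj_onI, rule ccontr)
    fix r r' assume "r \<in> R" "r' \<in> R" "L (r, c, k) = L (r', c, k)" "r \<noteq> r'"
    moreover have "r \<in> {1..N}" "r' \<in> {1..N}"
      using \<open>r \<in> R\<close> \<open>r' \<in> R\<close> bounds(1) by blast+
    ultimately show False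
      using neq[of "(r, c, k)" "(r', c, k)"] c kN
      by (simp add: differ_in_one_def)
  qed
  moreover have "(\<lambda>r. L (r, c, k)) ` R \<subseteq> S - ?T"
  proof (rule image_subsetI, rule DiffI)
    fix r assume r: "r \<in> R"
    then have rN: "r \<in> {1..N}"
      using bounds by blast
    then show "L (r, c, k) \<in> S"
      using LS c kN by blast
    \<comment> \<open>A subcube symbol at (r, c, k) would occur a second time on the same line of
      the large cube, at some c' in C, and c' differs from c because c is not in C.\<close>
    show "L (r, c, k) \<notin> ?T"
    proof
      assume "L (r, c, k) \<in> ?T"
      then obtain c' where c': "c' \<in> C" "L (r, c, k) = L (r, c', k)"
        using subcube_line_image[OF sub r k] by fastforce
      moreover have "c' \<in> {1..N}" "c \<noteq> c'"
        using c'(1) c(2) bounds(2) by blast+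
      ultimately show False
        using neq[of "(r, c, k)" "(r, c', k)"] c kN rN
        by (simp add: differ_in_one_def)
    qed
  qed
  ultimately have "card R \<le> card (S - ?T)"
    using S(1) by (intro card_inj_on_le) auto
  \<comment> \<open>With this inclusion, \<open>card (S - ?T)\<close> equals N - m, so the injection
    yields m \<le> N - m.\<close>
  moreover have "?T \<subseteq> S"
    using LS bounds by blast
  ultimately show ?thesis
    using cards S \<open>m < N\<close> by (simp add: card_Diff_subset)
qed simp

theorem theorem9:
  fixes n N :: nat and h :: "nat \<Rightarrow> nat"
  assumes "n \<ge> 2"
    and "\<forall>i\<in>{1..n}. \<forall>j\<in>{1..n}. i \<le> j \<longrightarrow> h j \<le> h i"
    and "h n > 0"
    and "N = (\<Sum>i=1..n. h i)"
    and "\<exists>(S :: 's set) L. LC n h S L"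
  shows "\<forall>i\<in>{1..n}. real (h i) \<le> real N / 2"
proof
  fix i assume i: "i \<in> {1..n}"
  obtain S :: "'s set" and L R C K where cube: "latin_cube N S L"
    and sub: "subcube N L (h i) (R i) (C i) (K i)"
    using assms(4,5) i unfolding LC_def Let_def by blast
  \<comment> \<open>Any second index will do: its order is at least \<open>h n\<close>, hence
    positive, which forces \<open>h i < N\<close> and makes the subcube of index i proper.\<close>
  obtain j where j: "j \<in> {1..n}" "j \<noteq> i"
  proof
    show "(if i = 1 then 2 else 1) \<in> {1..n}" "(if i = 1 then 2 else 1) \<noteq> i"
      using assms(1) by auto
  qed
  have "h n \<le> h j"
    using assms(1,2) j by auto
  then have "h i < h i + h j"
    using assms(3) by simp
  also have "\<dots> = sum h {i, j}"
    using j by simp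
  also have "\<dots> \<le> N"
    unfolding assms(4) using i j by (intro sum_mono2) auto
  finally have "2 * h i \<le> N"
    by (rule proper_subcube_order_le[OF cube sub])
  then show "real (h i) \<le> real N / 2"
    by linarith
qed

end
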